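(* Let $X,Y$ be complex Banach spaces, assume that $X$ is reflexive, and let $T\colon X\to X$ be a Ritt operator. Assume that $T$ satisfies a square function estimate, i.e. there exists a constant $\kappa\geq 0$ such that $$\sum_{k=1}^{\infty} k\,\bigl\Vert T^k(x)-T^{k-1}(x)\bigr\Vert^2\leq \kappa^2\Vert x\Vert^2,\qquad x\in X.$$ Let $\alpha>-1$ and $\beta\in(-1,3)$ be real numbers such that $m=\frac{\alpha+\beta}{2}$ is a nonnegative integer. Then a bounded operator $C\colon X\to Y$ is $\alpha$-admissible for $T$ if and only if there exists a constant $K\geq 0$ such that $$\bigl(1-\vert\omega\vert^2\bigr)^{\frac{1+\beta}{2}}\bigl\Vert C(I-\omega T)^{-(m+1)}\bigr\Vert\leq K,\qquad \omega\in\mathbb{D}.$$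
   Context: $\mathbb{D}=\{\omega\in\mathbb{C}: |\omega|<1\}$. A bounded operator $T\colon X\to X$ is power bounded if $\sup_{k\geq 0}\Vert T^k\Vert<\infty$. A power bounded operator $T$ is called a Ritt operator if there is a constant $c_1\ge 0$ with $k\Vert T^k-T^{k-1}\Vert\leq c_1$ for all integers $k\geq 1$. For a power bounded $T\colon X\to X$ and real $\alpha>-1$, a bounded operator $C\colon X\to Y$ is called $\alpha$-admissible for $T$ if there is a constant $M\geq 0$ such that $\sum_{k=0}^{\infty}(k+1)^{\alpha}\Vert CT^k(x)\Vert^2\leq M^2\Vert x\Vert^2$ for all $x\in X$. *)

theory Defs
  imports "HOL-Analysis.Analysis"
begin

section \<open>Complex Banach spaces\<close>

text \<open>
  The distribution only has real Banach spaces. A complex Banach space is a real Banach space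
  whose scalar multiplication extends to the complex numbers, with
  \<open>norm (c *\<^sub>C x) = cmod c * norm x\<close>.
\<close>

class complex_banach = banach +
  fixes scaleC :: "complex \<Rightarrow> 'a \<Rightarrow> 'a"  (infixr "*\<^sub>C" 75)
  assumes scaleC_add_right: "c *\<^sub>C (x + y) = c *\<^sub>C x + c *\<^sub>C y"
    and scaleC_add_left: "(c + d) *\<^sub>C x = c *\<^sub>C x + d *\<^sub>C x"
    and scaleC_scaleC: "c *\<^sub>C d *\<^sub>C x = (c * d) *\<^sub>C x"
    and scaleC_of_real: "complex_of_real r *\<^sub>C x = r *\<^sub>R x"
    and norm_scaleC: "norm (c *\<^sub>C x) = cmod c * norm x"

instantiation complex :: complex_banach
begin

definition scaleC_complex :: "complex \<Rightarrow> complex \<Rightarrow> complex" where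
  "scaleC_complex c x = c * x"

instance
  by standard (simp_all add: scaleC_complex_def algebra_simps norm_mult scaleR_conv_of_real)

end

text \<open>
  Bounded complex-linear operators. Their operator norm is the library's \<^const>\<open>onorm\<close>:
  the supremum of \<open>norm (f x) / norm x\<close> does not depend on the scalar field.
\<close>

definition bounded_clinear :: "('a::complex_banach \<Rightarrow> 'b::complex_banach) \<Rightarrow> bool" where
  "bounded_clinear f \<longleftrightarrow> bounded_linear f \<and> (\<forall>c x. f (c *\<^sub>C x) = c *\<^sub>C f x)"


section \<open>Reflexivity\<close>

definition dual_space :: "('a::complex_banach \<Rightarrow> complex) set" where
  "dual_space = {f. bounded_clinear f}"

text \<open>
  Elements of the bidual are maps defined on the set \<^const>\<open>dual_space\<close>; values outside that set
  are irrelevant.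
\<close>

definition bidual_functional :: "(('a::complex_banach \<Rightarrow> complex) \<Rightarrow> complex) \<Rightarrow> bool" where
  "bidual_functional \<Phi> \<longleftrightarrow>
     (\<forall>f\<in>dual_space. \<forall>g\<in>dual_space. \<Phi> (\<lambda>x. f x + g x) = \<Phi> f + \<Phi> g) \<and>
     (\<forall>c. \<forall>f\<in>dual_space. \<Phi> (\<lambda>x. c * f x) = c * \<Phi> f) \<and>
     (\<exists>M. \<forall>f\<in>dual_space. cmod (\<Phi> f) \<le> M * onorm f)"

text \<open>The space is the type, passed as a phantom argument: \<open>reflexive_space TYPE('a)\<close>.\<close>

definition reflexive_space :: "'a::complex_banach itself \<Rightarrow> bool" where
  "reflexive_space _ \<longleftrightarrow>
     (\<forall>\<Phi>. bidual_functional \<Phi> \<longrightarrow> (\<exists>x::'a. \<forall>f\<in>dual_space. \<Phi> f = f x))"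


section \<open>Ritt operators, square functions, admissibility\<close>

definition power_bounded :: "('a::complex_banach \<Rightarrow> 'a) \<Rightarrow> bool" where
  "power_bounded T \<longleftrightarrow> bounded_clinear T \<and> bdd_above (range (\<lambda>k. onorm (T ^^ k)))"

definition ritt_operator :: "('a::complex_banach \<Rightarrow> 'a) \<Rightarrow> bool" where
  "ritt_operator T \<longleftrightarrow> power_bounded T \<and>
     (\<exists>c\<^sub>1\<ge>0. \<forall>k\<ge>1. real k * onorm (\<lambda>x. (T ^^ k) x - (T ^^ (k - 1)) x) \<le> c\<^sub>1)"

text \<open>
  The series below have nonnegative terms, so a bound on the sum includes convergence; this has to
  be stated because \<^const>\<open>suminf\<close> is unspecified for divergent real series. In
  \<open>square_function_estimate\<close> the summation index is shifted to start at 0.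
\<close>

definition square_function_estimate :: "('a::complex_banach \<Rightarrow> 'a) \<Rightarrow> bool" where
  "square_function_estimate T \<longleftrightarrow>
     (\<exists>\<kappa>\<ge>0. \<forall>x.
        summable (\<lambda>k. real (Suc k) * (norm ((T ^^ Suc k) x - (T ^^ k) x))\<^sup>2) \<and>
        (\<Sum>k. real (Suc k) * (norm ((T ^^ Suc k) x - (T ^^ k) x))\<^sup>2) \<le> \<kappa>\<^sup>2 * (norm x)\<^sup>2)"

definition admissible ::
    "real \<Rightarrow> ('a::complex_banach \<Rightarrow> 'a) \<Rightarrow> ('a \<Rightarrow> 'b::complex_banach) \<Rightarrow> bool" where
  "admissible \<alpha> T C \<longleftrightarrow>
     (\<exists>M\<ge>0. \<forall>x.
        summable (\<lambda>k. (real k + 1) powr \<alpha> * (norm (C ((T ^^ k) x)))\<^sup>2) \<and>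
        (\<Sum>k. (real k + 1) powr \<alpha> * (norm (C ((T ^^ k) x)))\<^sup>2) \<le> M\<^sup>2 * (norm x)\<^sup>2)"


section \<open>The operators \<open>(I - \<omega> T)\<^sup>-\<^sup>1\<close>\<close>

definition resolvent_op :: "('a::complex_banach \<Rightarrow> 'a) \<Rightarrow> complex \<Rightarrow> 'a \<Rightarrow> 'a" where
  "resolvent_op T \<omega> = inv (\<lambda>x. x - \<omega> *\<^sub>C T x)"

text \<open>
  For power bounded \<open>T\<close> and \<open>\<omega>\<close> in the open unit disc, \<open>I - \<omega> T\<close> is a bijection with bounded
  inverse (Neumann series), so that \<^const>\<open>resolvent_op\<close> is the genuine inverse operator.
\<close>

lemma scaleC_one [simp]: "1 *\<^sub>C x = (x::'a::complex_banach)"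
  using scaleC_of_real[of 1 x] by simp

lemma scaleC_minus_right: "c *\<^sub>C (- x) = - (c *\<^sub>C (x::'a::complex_banach))"
proof -
  have "c *\<^sub>C (- x) + c *\<^sub>C x = c *\<^sub>C 0" by (simp flip: scaleC_add_right)
  also have "\<dots> = 0" using norm_scaleC[of c "0::'a"] by simp
  finally show ?thesis by (simp add: eq_neg_iff_add_eq_0)
qed

lemma bounded_clinear_funpow:
  fixes T :: "'a::complex_banach \<Rightarrow> 'a"
  assumes "bounded_clinear T"
  shows "bounded_clinear (T ^^ k)"
proof (induction k)
  case 0
  show ?case by (simp add: bounded_clinear_def id_def bounded_linear_ident)
next
  case (Suc k)
  with assms show ?case
    using bounded_linear_compose[of T "T ^^ k"] by (simp add: bounded_clinear_def comp_def)
qed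

lemma bounded_clinear_scaleC_comp:
  assumes "bounded_clinear T"
  shows "bounded_clinear (\<lambda>x. c *\<^sub>C T x)"
proof -
  have lin: "bounded_linear T" and cl: "\<And>d x. T (d *\<^sub>C x) = d *\<^sub>C T x"
    using assms by (auto simp: bounded_clinear_def)
  have "c *\<^sub>C r *\<^sub>R y = r *\<^sub>R c *\<^sub>C y" for r and y :: 'b
    by (metis mult.commute scaleC_of_real scaleC_scaleC)
  then have "bounded_linear (\<lambda>y::'b. c *\<^sub>C y)"
    by (intro bounded_linear_intro[where K = "cmod c"])
      (auto simp: scaleC_add_right norm_scaleC mult.commute)
  from bounded_linear_compose[OF this lin] show ?thesis
    by (simp add: bounded_clinear_def cl scaleC_scaleC mult.commute)
qed

lemma power_bounded_invertible:
  fixes T :: "'a::complex_banach \<Rightarrow> 'a"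
  assumes T: "power_bounded T" and \<omega>: "cmod \<omega> < 1"
  shows "bij (\<lambda>x. x - \<omega> *\<^sub>C T x)" and "bounded_clinear (resolvent_op T \<omega>)"
proof -
  define A where "A = (\<lambda>x. \<omega> *\<^sub>C T x)"
  define F where "F = (\<lambda>x. x - A x)"
  have T_cl: "bounded_clinear T" using T by (simp add: power_bounded_def)
  obtain B0 where B0: "\<And>k. onorm (T ^^ k) \<le> B0"
    using T by (auto simp: power_bounded_def bdd_above_def)
  define B where "B = max B0 0"
  have B: "onorm (T ^^ k) \<le> B" "B \<ge> 0" for k using B0[of k] by (auto simp: B_def)
  have A_cl: "bounded_clinear A" unfolding A_def by (rule bounded_clinear_scaleC_comp[OF T_cl])
  then have A_lin: "bounded_linear A" by (simp add: bounded_clinear_def)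
  have A_pow: "(A ^^ k) x = \<omega> ^ k *\<^sub>C (T ^^ k) x" for k x
  proof (induction k)
    case (Suc k)
    then show ?case using T_cl
      by (simp add: A_def bounded_clinear_def scaleC_scaleC)
  qed simp
  have bnd: "norm ((A ^^ k) x) \<le> cmod \<omega> ^ k * (B * norm x)" for k x
  proof -
    have "bounded_linear (T ^^ k)"
      using bounded_clinear_funpow[OF T_cl] by (simp add: bounded_clinear_def)
    from onorm[OF this, of x] have "norm ((T ^^ k) x) \<le> B * norm x"
      by (meson B(1) mult_right_mono norm_ge_zero order_trans)
    then show ?thesis by (simp add: A_pow norm_scaleC norm_power mult_left_mono)
  qed
  have geo: "summable (\<lambda>k. cmod \<omega> ^ k * (B * norm y))" for y :: 'a
    using \<omega> by (intro summable_mult2 summable_geometric) simp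
  have sm_norm: "summable (\<lambda>k. norm ((A ^^ k) y))" for y
    by (rule summable_comparison_test[OF _ geo[of y]]) (use bnd in auto)
  have sm: "summable (\<lambda>k. (A ^^ k) y)" for y
    by (rule summable_norm_cancel[OF sm_norm])
  have ker: "x = 0" if "F x = 0" for x
  proof -
    have "A x = x" using that by (simp add: F_def)
    then have "(A ^^ k) x = x" for k by (induction k) auto
    then have "(\<lambda>k. x) \<longlonglongrightarrow> 0" using summable_LIMSEQ_zero[OF sm[of x]] by simp
    then show "x = 0" using LIMSEQ_unique tendsto_const by blast
  qed
  have F_cl: "bounded_clinear F"
    unfolding F_def bounded_clinear_def
  proof (intro conjI allI)
    show "bounded_linear (\<lambda>x. x - A x)"
      by (intro bounded_linear_sub bounded_linear_ident A_lin)
    show "c *\<^sub>C x - A (c *\<^sub>C x) = c *\<^sub>C (x - A x)" for c x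
      using A_cl scaleC_add_right[of c x "- A x"]
      by (simp add: bounded_clinear_def scaleC_minus_right)
  qed
  then have F_lin: "bounded_linear F" by (simp add: bounded_clinear_def)
  have inj: "inj F"
    by (rule injI) (metis F_lin ker bounded_linear.linear linear_diff right_minus_eq)
  have FG: "F (\<Sum>k. (A ^^ k) y) = y" for y
  proof -
    have "A (\<Sum>k. (A ^^ k) y) = (\<Sum>k. (A ^^ Suc k) y)"
      by (simp add: bounded_linear.suminf[OF A_lin sm])
    also have "\<dots> = (\<Sum>k. (A ^^ k) y) - y"
      using suminf_split_head[OF sm[of y]] by simp
    finally show ?thesis by (simp add: F_def)
  qed
  have bij: "bij F" unfolding bij_def using inj surjI[of F, OF FG] by blast
  have inv_eq: "inv F y = (\<Sum>k. (A ^^ k) y)" for y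
    by (rule inv_f_eq[OF inj FG])
  have inv_bnd: "norm (inv F y) \<le> norm y * ((\<Sum>k. cmod \<omega> ^ k) * B)" for y
  proof -
    have "norm (inv F y) \<le> (\<Sum>k. norm ((A ^^ k) y))"
      unfolding inv_eq by (rule summable_norm[OF sm_norm])
    also have "\<dots> \<le> (\<Sum>k. cmod \<omega> ^ k * (B * norm y))"
      by (rule suminf_le[OF bnd sm_norm geo])
    also have "\<dots> = norm y * ((\<Sum>k. cmod \<omega> ^ k) * B)"
      using \<omega> by (subst suminf_mult2[symmetric]) (auto intro: summable_geometric)
    finally show ?thesis .
  qed
  have F_inv: "F (inv F y) = y" for y using bij by (simp add: bij_is_surj surj_f_inv_f)
  have add: "inv F (x + y) = inv F x + inv F y" for x y
    by (rule inv_f_eq[OF inj]) (simp add: linear_add[OF bounded_linear.linear[OF F_lin]] F_inv)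
  have scC: "inv F (c *\<^sub>C x) = c *\<^sub>C inv F x" for c x
    by (rule inv_f_eq[OF inj]) (use F_cl F_inv in \<open>simp add: bounded_clinear_def\<close>)
  have "bounded_linear (inv F)"
    by (rule bounded_linear_intro[OF add _ inv_bnd]) (metis scC scaleC_of_real)
  with scC bij show "bij (\<lambda>x. x - \<omega> *\<^sub>C T x)" "bounded_clinear (resolvent_op T \<omega>)"
    by (simp_all add: bounded_clinear_def resolvent_op_def F_def A_def)
qed

end

theory Submission
  imports Defs
begin

text \<open>
  If \<open>C\<close> is admissible, expand \<open>(I - \<omega> T)\<^sup>-\<^sup>(\<^sup>m\<^sup>+\<^sup>1\<^sup>)\<close> in a binomial series and apply Cauchy-Schwarz together with
  \<open>\<Sum>(k+1)\<^sup>\<beta> |\<omega>|\<^sup>2\<^sup>k = O((1 - |\<omega>|\<^sup>2)\<^sup>-\<^sup>1\<^sup>-\<^sup>\<beta>)\<close>.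

  For the converse, only real \<open>\<omega> = k/(k+1)\<close> matter. There the Ritt condition makes
  \<open>(I - \<omega> T) T\<^sup>k = (T\<^sup>k - T\<^sup>k\<^sup>+\<^sup>1) + T\<^sup>k\<^sup>+\<^sup>1/(k+1)\<close> of size \<open>O(1/k)\<close>, so that cancelling the resolvents
  in \<open>C (I - \<omega> T)\<^sup>-\<^sup>p ((I - \<omega> T) T\<^sup>k)\<^sup>p = C T\<^sup>k\<^sup>p\<close>, with \<open>p = m + 1\<close>, gives the decay
  \<open>\<parallel>C T\<^sup>n\<parallel> = O(n\<^sup>-\<^sup>e)\<close> with \<open>e = (1+\<alpha>)/2 > 0\<close>. In particular \<open>C T\<^sup>n \<rightarrow> 0\<close>, hence
  \<open>C T\<^sup>2\<^sup>k x = \<Sum>\<^sub>j\<^sub>\<ge>\<^sub>k C T\<^sup>j (I + T) (T\<^sup>j - T\<^sup>j\<^sup>+\<^sup>1) x\<close>, and a weighted Hardy inequality bounds the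
  admissibility sum by the square function of \<open>x\<close>.
\<close>

section \<open>Sums of powers and a weighted discrete Hardy inequality\<close>

text \<open>This makes the power sum telescope. For a \<le> 1 the mean value theorem applies and the
  decreasing derivative costs the factor 1/a; for a > 1 the bound n^a \<le> n (n+1)^(a-1) gives the
  constant 1.\<close>

lemma powr_le_diff:
  assumes "a > 0"
  shows "real (Suc n) powr (a - 1) \<le> max 1 (1 / a) * (real (Suc n) powr a - real n powr a)"
proof (cases "n = 0")
  case False
  show ?thesis
  proof (cases "a \<le> 1")
    case True
    have "\<exists>z>real n. z < real (Suc n) \<and>
        real (Suc n) powr a - real n powr a = (real (Suc n) - real n) * (a * z powr (a - 1))"
      using \<open>n \<noteq> 0\<close> by (intro MVT2) (auto intro!: derivative_eq_intros)
    then obtain z where z: "real n < z" "z < real (Suc n)"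
      "real (Suc n) powr a - real n powr a = a * z powr (a - 1)" by auto
    have "real (Suc n) powr (a - 1) \<le> z powr (a - 1)"
      using z True by (intro powr_mono2') auto
    also have "\<dots> = 1 / a * (real (Suc n) powr a - real n powr a)"
      using z(3) assms by simp
    finally show ?thesis using True assms by (simp add: max_def)
  next
    case False
    have "real n powr a = real n * real n powr (a - 1)"
      using \<open>n \<noteq> 0\<close> by (simp add: powr_diff)
    also have "\<dots> \<le> real n * real (Suc n) powr (a - 1)"
      using False by (intro mult_left_mono powr_mono2) auto
    finally have "real (Suc n) powr (a - 1) \<le> real (Suc n) * real (Suc n) powr (a - 1) - real n powr a"
      by (simp add: algebra_simps)
    also have "real (Suc n) * real (Suc n) powr (a - 1) = real (Suc n) powr a"
      by (simp add: powr_diff)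
    finally show ?thesis using False by (simp add: max_def)
  qed
qed auto

lemma sum_powr_le:
  assumes "a > 0"
  shows "(\<Sum>k<n. real (Suc k) powr (a - 1)) \<le> max 1 (1 / a) * real n powr a"
proof (induction n)
  case (Suc n)
  then show ?case using powr_le_diff[OF assms, of n] by (simp add: algebra_simps)
qed simp

text \<open>Comparison with the integral of x^(-1-a): the mean value theorem yields a point z < j+2
  \<le> 2(j+1), and replacing z by 2(j+1) costs 2^(1+a). Telescoping then leaves only the value at
  k.\<close>

lemma sum_powr_tail_le:
  assumes "a > 0"
  shows "(\<Sum>j=k..<n. real (Suc j) powr (- 1 - a)) \<le> 2 powr (1 + a) / a * real (Suc k) powr (- a)"
proof (cases "k \<le> n")
  case True
  let ?c = "2 powr (1 + a) / a"
  define f where "f j = - (?c * real (Suc j) powr (- a))" for j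
  have step: "real (Suc j) powr (- 1 - a) \<le> f (Suc j) - f j" for j
  proof -
    have "\<exists>z>real (Suc j). z < real (Suc (Suc j)) \<and>
        real (Suc (Suc j)) powr (- a) - real (Suc j) powr (- a)
          = (real (Suc (Suc j)) - real (Suc j)) * ((- a) * z powr (- a - 1))"
      by (intro MVT2) (auto intro!: derivative_eq_intros)
    then obtain z where z: "real (Suc j) < z" "z < real (Suc (Suc j))"
      "real (Suc j) powr (- a) - real (Suc (Suc j)) powr (- a) = a * z powr (- a - 1)" by auto
    have "real (Suc j) powr (- 1 - a) = 2 powr (1 + a) * (2 * real (Suc j)) powr (- a - 1)"
      by (simp add: powr_mult powr_diff powr_add powr_minus divide_simps del: of_nat_Suc)
    also have "\<dots> \<le> 2 powr (1 + a) * z powr (- a - 1)"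
      using z assms by (intro mult_left_mono powr_mono2') auto
    also have "\<dots> = ?c * (a * z powr (- a - 1))" using assms by simp
    finally show ?thesis by (simp add: f_def z(3)[symmetric] right_diff_distrib del: of_nat_Suc)
  qed
  have "(\<Sum>j=k..<n. real (Suc j) powr (- 1 - a)) \<le> (\<Sum>j=k..<n. f (Suc j) - f j)"
    by (intro sum_mono step)
  also have "\<dots> = f n - f k" using True by (rule sum_Suc_diff')
  also have "\<dots> \<le> - f k" using assms by (simp add: f_def)
  finally show ?thesis by (simp add: f_def)
qed (use assms in auto)

text \<open>After Cauchy-Schwarz and an exchange of summation, the weights (k+1)^(e-1) with k \<le>
  j add up to O((j+1)^e), which together with the leftover (j+1)^(1-e) gives the weight j+1. Both
  sums are cut off at the same n, so convergence is no issue, and \<open>H\<close> is independent of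
  n.\<close>

lemma discrete_hardy:
  fixes e :: real
  assumes "e > 0"
  obtains H where "H \<ge> 0"
    "\<And>g n. (\<Sum>k<n. real (Suc k) powr (2 * e - 1) * (\<Sum>j=k..<n. real (Suc j) powr (- e) * g j)\<^sup>2)
            \<le> H * (\<Sum>j<n. real (Suc j) * (g j)\<^sup>2)"
proof
  let ?A = "2 powr (1 + e) / e" and ?B = "max 1 (1 / e)"
  show "?A * ?B \<ge> 0" using assms by simp
  fix g :: "nat \<Rightarrow> real" and n
  define G where "G j = real (Suc j) powr (1 - e) * (g j)\<^sup>2" for j
  \<comment> \<open>Cauchy-Schwarz with the splitting \<open>-e = (-1-e)/2 + (1-e)/2\<close>: the first weight is square summable,
    with tail of order \<open>k\<^sup>-\<^sup>e\<close>.\<close>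
  have cs: "real (Suc k) powr (2 * e - 1) * (\<Sum>j=k..<n. real (Suc j) powr (- e) * g j)\<^sup>2
      \<le> (\<Sum>j=k..<n. ?A * (real (Suc k) powr (e - 1) * G j))" for k
  proof -
    have "(\<Sum>j=k..<n. real (Suc j) powr (- e) * g j)\<^sup>2
      = (\<Sum>j=k..<n. real (Suc j) powr ((- 1 - e) / 2) * (real (Suc j) powr ((1 - e) / 2) * g j))\<^sup>2"
      by (simp add: field_simps flip: powr_add)
    also have "\<dots> \<le> (\<Sum>j=k..<n. (real (Suc j) powr ((- 1 - e) / 2))\<^sup>2)
        * (\<Sum>j=k..<n. (real (Suc j) powr ((1 - e) / 2) * g j)\<^sup>2)"
      by (rule Cauchy_Schwarz_ineq_sum)
    also have "\<dots> = (\<Sum>j=k..<n. real (Suc j) powr (- 1 - e)) * (\<Sum>j=k..<n. G j)"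
    proof -
      have "(real (Suc j) powr (y / 2))\<^sup>2 = real (Suc j) powr y" for j y
        by (simp add: power2_eq_square flip: powr_add)
      then show ?thesis by (simp only: G_def power_mult_distrib)
    qed
    also have "\<dots> \<le> ?A * real (Suc k) powr (- e) * (\<Sum>j=k..<n. G j)"
      by (intro mult_right_mono sum_powr_tail_le assms sum_nonneg) (simp add: G_def)
    finally have "real (Suc k) powr (2 * e - 1) * (\<Sum>j=k..<n. real (Suc j) powr (- e) * g j)\<^sup>2
        \<le> real (Suc k) powr (2 * e - 1) * (?A * real (Suc k) powr (- e) * (\<Sum>j=k..<n. G j))"
      by (intro mult_left_mono) auto
    also have "\<dots> = ?A * ((real (Suc k) powr (2 * e - 1) * real (Suc k) powr (- e)) * (\<Sum>j=k..<n. G j))"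
      by (simp only: mult_ac)
    also have "real (Suc k) powr (2 * e - 1) * real (Suc k) powr (- e) = real (Suc k) powr (e - 1)"
      by (simp flip: powr_add)
    finally show ?thesis by (simp add: sum_distrib_left)
  qed
  have "(\<Sum>k<n. real (Suc k) powr (2 * e - 1) * (\<Sum>j=k..<n. real (Suc j) powr (- e) * g j)\<^sup>2)
      \<le> (\<Sum>k<n. \<Sum>j=k..<n. ?A * (real (Suc k) powr (e - 1) * G j))"
    by (intro sum_mono cs)
  \<comment> \<open>Both double sums run over the triangle k \<le> j < n.\<close>
  also have "\<dots> = (\<Sum>j<n. \<Sum>k<Suc j. ?A * (real (Suc k) powr (e - 1) * G j))"
    unfolding sum.Sigma[OF finite_lessThan ballI[OF finite_atLeastLessThan]]
      sum.Sigma[OF finite_lessThan ballI[OF finite_lessThan]]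
    by (rule sum.reindex_bij_witness[of _ prod.swap prod.swap]) auto
  also have "\<dots> = (\<Sum>j<n. ?A * ((\<Sum>k<Suc j. real (Suc k) powr (e - 1)) * G j))"
    by (simp only: sum_distrib_left sum_distrib_right)
  also have "\<dots> \<le> (\<Sum>j<n. ?A * ((?B * real (Suc j) powr e) * G j))"
    using assms by (intro sum_mono mult_left_mono mult_right_mono sum_powr_le) (auto simp: G_def)
  also have "\<dots> = (\<Sum>j<n. ?A * ?B * (real (Suc j) * (g j)\<^sup>2))"
  proof (intro sum.cong refl)
    fix j
    have "real (Suc j) powr e * real (Suc j) powr (1 - e) = real (Suc j)"
      by (simp flip: powr_add)
    then show "?A * ((?B * real (Suc j) powr e) * G j) = ?A * ?B * (real (Suc j) * (g j)\<^sup>2)"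
      unfolding G_def by (metis (no_types, opaque_lifting) mult.assoc)
  qed
  finally show "(\<Sum>k<n. real (Suc k) powr (2 * e - 1) * (\<Sum>j=k..<n. real (Suc j) powr (- e) * g j)\<^sup>2)
      \<le> ?A * ?B * (\<Sum>j<n. real (Suc j) * (g j)\<^sup>2)"
    by (simp add: sum_distrib_left)
qed

section \<open>Growth of the weighted geometric series near r = 1\<close>

text \<open>Raise v \<le> exp v, with v = u/(2b), to the power b. The base 2b+1 in place of 2b
  covers b = 0, where \<open>0 powr 0 = 0\<close> would make the right-hand side vanish.\<close>

lemma powr_le_exp:
  fixes b u :: real
  assumes "b \<ge> 0" "u > 0"
  shows "u powr b \<le> (2 * b + 1) powr b * exp (u / 2)"
proof (cases "b = 0")
  case False
  with assms have b: "b > 0" by simp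
  have "u / (2 * b) \<le> exp (u / (2 * b))"
    using exp_ge_add_one_self[of "u / (2 * b)"] by linarith
  then have "(u / (2 * b)) powr b \<le> exp (u / (2 * b)) powr b"
    using assms b by (intro powr_mono2) auto
  then have "u powr b \<le> (2 * b) powr b * exp (u / 2)"
    using assms b by (simp add: powr_divide powr_def[of "exp _"] field_simps)
  also have "\<dots> \<le> (2 * b + 1) powr b * exp (u / 2)"
    using b by (intro mult_right_mono powr_mono2) auto
  finally show ?thesis .
qed (use assms in auto)

text \<open>Put t = 1 - r. For b \<ge> 0, r^k \<le> exp(-kt); half of this exponential absorbs the
  power of k, the other half is summed geometrically. For b < 0 the sum is split near k = 1/t:
  below, r^k \<le> 1 and the plain power sum is used; above, the weight is at most t^(-b).\<close>

lemma powr_series_bound: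
  fixes b :: real
  assumes "b > - 1"
  obtains K where "K \<ge> 0"
    "\<And>r. 0 \<le> r \<Longrightarrow> r < 1 \<Longrightarrow> summable (\<lambda>k. real (Suc k) powr b * r ^ k)"
    "\<And>r. 0 \<le> r \<Longrightarrow> r < 1 \<Longrightarrow> (\<Sum>k. real (Suc k) powr b * r ^ k) \<le> K * (1 - r) powr - (1 + b)"
proof (cases "b \<ge> 0")
  case True
  let ?D = "(2 * b + 1) powr b * exp (1 / 2)"
  have *: "summable (\<lambda>k. real (Suc k) powr b * r ^ k) \<and>
    (\<Sum>k. real (Suc k) powr b * r ^ k) \<le> 3 * ?D * (1 - r) powr - (1 + b)" if r: "0 \<le> r" "r < 1" for r
  proof -
    define t where "t = 1 - r"
    have t: "0 < t" "t \<le> 1" using r by (auto simp: t_def)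
    \<comment> \<open>The factor exp(1/2) in \<open>?D\<close> pays for the shift from k to k+1:
      (k+1)t/2 \<le> 1/2 + kt/2, as t \<le> 1.\<close>
    have term_le: "real (Suc k) powr b * r ^ k \<le> ?D * t powr - b * exp (- (t / 2)) ^ k" for k
    proof -
      have "r \<le> exp (- t)" using exp_ge_add_one_self[of "- t"] by (simp add: t_def)
      then have "r ^ k \<le> exp (- t) ^ k" using r by (intro power_mono) auto
      also have "\<dots> = exp (- (real k * t))" by (simp flip: exp_of_nat_mult)
      finally have rk: "r ^ k \<le> exp (- (real k * t))" .
      have "real (Suc k) powr b = (real (Suc k) * t) powr b * t powr - b"
        using t by (simp add: powr_mult powr_minus)
      also have "\<dots> \<le> ((2 * b + 1) powr b * exp (real (Suc k) * t / 2)) * t powr - b"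
        using t True by (intro mult_right_mono powr_le_exp) auto
      also have "\<dots> \<le> ((2 * b + 1) powr b * (exp (1/2) * exp (real k * t / 2))) * t powr - b"
        using t unfolding exp_add[symmetric]
        by (intro mult_right_mono mult_left_mono iffD2[OF exp_le_cancel_iff])
          (auto simp: field_simps)
      finally have "real (Suc k) powr b \<le> ?D * t powr - b * exp (real k * t / 2)"
        by (simp add: mult_ac)
      then have "real (Suc k) powr b * r ^ k \<le> (?D * t powr - b * exp (real k * t / 2)) * exp (- (real k * t))"
        using rk r by (intro mult_mono) auto
      also have "\<dots> = ?D * t powr - b * (exp (real k * t / 2) * exp (- (real k * t)))"
        by (simp only: mult.assoc)
      also have "exp (real k * t / 2) * exp (- (real k * t)) = exp (- (t / 2)) ^ k"
        by (simp flip: exp_add exp_of_nat_mult)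
      finally show ?thesis .
    qed
    have geo: "(\<lambda>k. ?D * t powr - b * exp (- (t / 2)) ^ k) sums (?D * t powr - b * (1 / (1 - exp (- (t / 2)))))"
      using t by (intro sums_mult geometric_sums) auto
    have sm: "summable (\<lambda>k. real (Suc k) powr b * r ^ k)"
      by (rule summable_comparison_test[OF _ sums_summable[OF geo]]) (use term_le r in auto)
    \<comment> \<open>Source of the factor 3: (1 - t/3)(1 + t/2) = 1 + (t - t^2)/6 \<ge> 1 for 0 < t
      \<le> 1.\<close>
    have "exp (- (t / 2)) \<le> 1 / (1 + t / 2)"
      using t exp_ge_add_one_self[of "t / 2"] by (simp add: exp_minus field_simps)
    also have "\<dots> \<le> 1 - t / 3"
      using t mult_left_le[of t t] by (simp add: field_simps)
    finally have "1 / (1 - exp (- (t / 2))) \<le> 3 / t"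
      using t by (simp add: field_simps)
    have "(\<Sum>k. real (Suc k) powr b * r ^ k) \<le> ?D * t powr - b * (1 / (1 - exp (- (t / 2))))"
      using suminf_le[OF term_le sm sums_summable[OF geo]] sums_unique[OF geo] by simp
    also have "\<dots> \<le> ?D * t powr - b * (3 / t)"
      using \<open>1 / (1 - exp (- (t / 2))) \<le> 3 / t\<close> by (intro mult_left_mono) auto
    also have "\<dots> = 3 * ?D * t powr - (1 + b)"
      using t by (simp add: powr_add powr_minus powr_diff field_simps)
    finally show ?thesis using sm by (simp add: t_def)
  qed
  show ?thesis
    by (rule that[of "3 * ?D"]) (use * in auto)
next
  case False
  let ?c = "max 1 (1 / (1 + b)) * 2 powr (1 + b)"
  have *: "summable (\<lambda>k. real (Suc k) powr b * r ^ k) \<and>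
    (\<Sum>k. real (Suc k) powr b * r ^ k) \<le> (?c + 1) * (1 - r) powr - (1 + b)" if r: "0 \<le> r" "r < 1" for r
  proof -
    define t where "t = 1 - r"
    have t: "0 < t" "t \<le> 1" using r by (auto simp: t_def)
    \<comment> \<open>The cut-off is comparable to 1/t from both sides: the lower bound controls the
      tail weights, the upper one the initial sum.\<close>
    define n where "n = nat \<lceil>1 / t\<rceil>"
    have "1 / t \<ge> 1" using t by simp
    then have n: "1 / t \<le> real n" "real n \<le> 2 / t" unfolding n_def by linarith+
    define f where "f k = (if k \<in> {..<n} then real (Suc k) powr b else 0)" for k
    have term_le: "real (Suc k) powr b * r ^ k \<le> f k + t powr - b * r ^ k" for k
    proof (cases "k < n")
      case True
      then show ?thesis using r power_le_one[of r k]
        by (simp add: f_def mult_left_le add_increasing2)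
    next
      case F: False
      then have "real (Suc k) powr b \<le> (1 / t) powr b"
        using n t False by (intro powr_mono2') auto
      then have "real (Suc k) powr b \<le> t powr - b"
        using t by (simp add: powr_divide powr_minus_divide)
      then have "real (Suc k) powr b * r ^ k \<le> t powr - b * r ^ k"
        using r by (intro mult_right_mono) auto
      then show ?thesis using F by (simp add: f_def)
    qed
    have fs: "f sums (\<Sum>k<n. real (Suc k) powr b)"
      unfolding f_def by (rule sums_If_finite_set) simp
    have geo: "(\<lambda>k. f k + t powr - b * r ^ k) sums ((\<Sum>k<n. real (Suc k) powr b) + t powr - b * (1 / (1 - r)))"
      using r by (intro sums_add fs sums_mult geometric_sums) auto
    have sm: "summable (\<lambda>k. real (Suc k) powr b * r ^ k)"
      by (rule summable_comparison_test[OF _ sums_summable[OF geo]]) (use term_le r in auto)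
    have "(\<Sum>k<n. real (Suc k) powr b) \<le> max 1 (1 / (1 + b)) * real n powr (1 + b)"
      using sum_powr_le[of "1 + b" n] assms by simp
    also have "\<dots> \<le> max 1 (1 / (1 + b)) * (2 / t) powr (1 + b)"
      using n assms by (intro mult_left_mono powr_mono2) auto
    also have "\<dots> = ?c * t powr - (1 + b)"
      using t by (simp add: powr_divide powr_minus_divide[of t] del: minus_add_distrib)
    finally have "(\<Sum>k<n. real (Suc k) powr b) + t powr - b * (1 / (1 - r))
        \<le> ?c * t powr - (1 + b) + t powr - b * (1 / t)"
      by (simp add: t_def)
    also have "t powr - b * (1 / t) = t powr - (1 + b)"
      using t powr_diff[of t "- b" 1] by (simp add: minus_diff_commute)
    finally have "(\<Sum>k. real (Suc k) powr b * r ^ k) \<le> (?c + 1) * t powr - (1 + b)"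
      using suminf_le[OF term_le sm sums_summable[OF geo]] sums_unique[OF geo]
      by (simp add: distrib_right)
    then show ?thesis using sm by (simp add: t_def)
  qed
  show ?thesis
    by (rule that[of "?c + 1"]) (use * in auto)
qed

section \<open>Pointwise operator bounds and the binomial series for resolvent powers\<close>

lemma power_boundedE:
  assumes "power_bounded T"
  obtains B where "B \<ge> 0" "\<And>k x. norm ((T ^^ k) x) \<le> B * norm x"
proof -
  have T: "bounded_clinear T" using assms by (simp add: power_bounded_def)
  obtain B where B: "\<And>k. onorm (T ^^ k) \<le> B"
    using assms by (auto simp: power_bounded_def bdd_above_def)
  have lin: "bounded_linear (T ^^ k)" for k
    using bounded_clinear_funpow[OF T] by (simp add: bounded_clinear_def)
  show ?thesis
  proof
    show "B \<ge> 0" using onorm_pos_le[OF lin] B order_trans by blast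
    show "norm ((T ^^ k) x) \<le> B * norm x" for k x
      using onorm[OF lin[of k], of x] mult_right_mono[OF B norm_ge_zero] by (rule order_trans)
  qed
qed

lemma ritt_operatorE:
  assumes "ritt_operator T"
  obtains c where "c \<ge> 0"
    "\<And>k x. norm ((T ^^ Suc k) x - (T ^^ k) x) \<le> c / real (Suc k) * norm x"
proof -
  have T: "bounded_clinear T" using assms by (simp add: ritt_operator_def power_bounded_def)
  obtain c where c: "c \<ge> 0"
    "\<And>k. k \<ge> 1 \<Longrightarrow> real k * onorm (\<lambda>x. (T ^^ k) x - (T ^^ (k - 1)) x) \<le> c"
    using assms by (auto simp: ritt_operator_def)
  have lin: "bounded_linear (T ^^ k)" for k
    using bounded_clinear_funpow[OF T] by (simp add: bounded_clinear_def)
  show ?thesis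
  proof
    show "c \<ge> 0" by fact
    fix k x
    have "onorm (\<lambda>x. (T ^^ Suc k) x - (T ^^ k) x) \<le> c / real (Suc k)"
      using c(2)[of "Suc k"] by (simp add: field_simps)
    from mult_right_mono[OF this norm_ge_zero]
    show "norm ((T ^^ Suc k) x - (T ^^ k) x) \<le> c / real (Suc k) * norm x"
      by (rule order_trans[OF onorm[OF bounded_linear_sub[OF lin lin]]])
  qed
qed

lemma resolvent_op_cancel:
  assumes "power_bounded T" "cmod \<omega> < 1"
  shows "resolvent_op T \<omega> (x - \<omega> *\<^sub>C T x) = x"
  unfolding resolvent_op_def
  using inv_f_f[OF bij_is_inj[OF power_bounded_invertible(1)[OF assms]], of x] by simp

text \<open>Absorption identity (p+1) binom(k+p+1, p+1) = (k+p+1) binom(k+p, p), together with k+p+1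
  \<le> (p+1)(k+1).\<close>

lemma binomial_add_le_power: "(k + p) choose p \<le> Suc k ^ p"
proof (induction p)
  case (Suc p)
  have "Suc p * ((k + Suc p) choose Suc p) = Suc (k + p) * ((k + p) choose p)"
    using Suc_times_binomial[of p "k + p"] by simp
  also have "\<dots> \<le> (Suc p * Suc k) * Suc k ^ p"
    using Suc.IH by (intro mult_mono) auto
  finally have "Suc p * ((k + Suc p) choose Suc p) \<le> Suc p * Suc k ^ Suc p"
    by (simp only: mult.assoc power_Suc)
  then show ?case by (simp only: mult_le_cancel1)
qed simp

text \<open>No products of series are formed. The candidate sums satisfy (I - \<omega>T) S_0 = x and
  (I - \<omega>T) S_(p+1) = S_p, so applying the resolvent as a left inverse gives the claim by
  induction on p.\<close>

lemma resolvent_op_funpow_sums: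
  fixes T :: "'a::complex_banach \<Rightarrow> 'a"
  assumes T: "power_bounded T" and \<omega>: "cmod \<omega> < 1"
  shows "(\<lambda>k. (of_nat ((k + p) choose p) * \<omega> ^ k) *\<^sub>C (T ^^ k) x)
    sums (resolvent_op T \<omega> ^^ Suc p) x"
proof -
  define a where "a p k = of_nat ((k + p) choose p) * \<omega> ^ k" for p k
  define S where "S p = (\<Sum>k. a p k *\<^sub>C (T ^^ k) x)" for p
  define A where "A x = \<omega> *\<^sub>C T x" for x
  have T_cl: "bounded_clinear T" using T by (simp add: power_bounded_def)
  then have A: "bounded_linear A"
    using bounded_clinear_scaleC_comp unfolding A_def bounded_clinear_def by blast
  obtain B where B: "B \<ge> 0" "\<And>k x. norm ((T ^^ k) x) \<le> B * norm x"
    using power_boundedE[OF T] by blast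
  have sm: "summable (\<lambda>k. a p k *\<^sub>C (T ^^ k) x)" for p
  proof (rule summable_comparison_test)
    have "summable (\<lambda>k. real (Suc k) powr real p * cmod \<omega> ^ k)"
      by (rule powr_series_bound[of "real p"]) (use \<omega> in auto)
    then show "summable (\<lambda>k. real (Suc k) powr real p * cmod \<omega> ^ k * (B * norm x))"
      by (rule summable_mult2)
    have "norm (a p k *\<^sub>C (T ^^ k) x) \<le> real (Suc k) powr real p * cmod \<omega> ^ k * (B * norm x)" for k
    proof -
      have "real ((k + p) choose p) \<le> real (Suc k) powr real p"
        using binomial_add_le_power[of k p] by (simp add: powr_realpow del: of_nat_Suc flip: of_nat_power)
      with B show ?thesis
        unfolding norm_scaleC a_def norm_mult norm_power norm_of_nat
        by (intro mult_mono) auto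
    qed
    then show "\<exists>N. \<forall>k\<ge>N. norm (a p k *\<^sub>C (T ^^ k) x) \<le> real (Suc k) powr real p * cmod \<omega> ^ k * (B * norm x)"
      by blast
  qed
  have split: "(\<Sum>k. a p (Suc k) *\<^sub>C (T ^^ Suc k) x) = S p - x" for p
    using suminf_split_head[OF sm[of p]] by (simp add: S_def a_def)
  have AS: "(\<lambda>k. (\<omega> * a p k) *\<^sub>C (T ^^ Suc k) x) sums A (S p)" for p
  proof -
    have "A (a p k *\<^sub>C (T ^^ k) x) = (\<omega> * a p k) *\<^sub>C (T ^^ Suc k) x" for k
      using T_cl by (simp add: A_def bounded_clinear_def scaleC_scaleC)
    then show ?thesis
      using bounded_linear.sums[OF A summable_sums[OF sm[of p]]] by (simp add: S_def)
  qed
  have "a 0 (Suc k) = \<omega> * a 0 k" for k by (simp add: a_def)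
  then have F0: "S 0 - A (S 0) = x"
    using split[of 0] sums_unique[OF AS[of 0]] by simp
  \<comment> \<open>Pascal's rule for the coefficients; summing it from index 1 gives S_(p+1) - x =
    A S_(p+1) + (S_p - x).\<close>
  have FS: "S (Suc p) - A (S (Suc p)) = S p" for p
  proof -
    have "a (Suc p) (Suc k) = \<omega> * a (Suc p) k + a p (Suc k)" for k
      by (simp add: a_def algebra_simps)
    moreover have "(\<lambda>k. a p (Suc k) *\<^sub>C (T ^^ Suc k) x) sums (S p - x)"
      using sm[of p] split[of p] summable_Suc_iff[of "\<lambda>k. a p k *\<^sub>C (T ^^ k) x"]
      by (simp add: sums_iff del: funpow.simps)
    ultimately have "(\<lambda>k. a (Suc p) (Suc k) *\<^sub>C (T ^^ Suc k) x) sums (A (S (Suc p)) + (S p - x))"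
      using sums_add[OF AS[of "Suc p"]] by (simp add: scaleC_add_left del: funpow.simps)
    then show ?thesis
      using split[of "Suc p"] sums_unique by (fastforce simp: algebra_simps)
  qed
  have R: "resolvent_op T \<omega> (y - A y) = y" for y
    unfolding A_def by (rule resolvent_op_cancel[OF T \<omega>])
  have "(resolvent_op T \<omega> ^^ Suc p) x = S p"
  proof (induction p)
    case 0
    then show ?case using R[of "S 0"] by (simp add: F0)
  next
    case (Suc p)
    then show ?case using R[of "S (Suc p)"] by (simp add: FS)
  qed
  then show ?thesis using summable_sums[OF sm[of p]] by (simp add: S_def a_def)
qed

section \<open>From admissibility to the resolvent bound\<close>

lemma admissible_imp_resolvent_bound:
  fixes T :: "'a::complex_banach \<Rightarrow> 'a" and C :: "'a \<Rightarrow> 'b::complex_banach"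
  assumes T: "power_bounded T" and C: "bounded_clinear C" and adm: "admissible \<alpha> T C"
    and "- 1 < \<beta>" and m: "real m = (\<alpha> + \<beta>) / 2"
  obtains K where "K \<ge> 0" "\<And>\<omega>. cmod \<omega> < 1 \<Longrightarrow>
    (1 - (cmod \<omega>)\<^sup>2) powr ((1 + \<beta>) / 2) * onorm (C \<circ> (resolvent_op T \<omega> ^^ (m + 1))) \<le> K"
proof -
  obtain M where M: "M \<ge> 0"
    "\<And>x. summable (\<lambda>k. (real k + 1) powr \<alpha> * (norm (C ((T ^^ k) x)))\<^sup>2)"
    "\<And>x. (\<Sum>k. (real k + 1) powr \<alpha> * (norm (C ((T ^^ k) x)))\<^sup>2) \<le> M\<^sup>2 * (norm x)\<^sup>2"
    using adm unfolding admissible_def by blast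
  obtain K where K: "K \<ge> 0"
    "\<And>r. 0 \<le> r \<Longrightarrow> r < 1 \<Longrightarrow> summable (\<lambda>k. real (Suc k) powr \<beta> * r ^ k)"
    "\<And>r. 0 \<le> r \<Longrightarrow> r < 1 \<Longrightarrow> (\<Sum>k. real (Suc k) powr \<beta> * r ^ k) \<le> K * (1 - r) powr - (1 + \<beta>)"
    using powr_series_bound[OF \<open>- 1 < \<beta>\<close>] by blast
  have C_lin: "bounded_linear C" and C_sc: "\<And>c x. C (c *\<^sub>C x) = c *\<^sub>C C x"
    using C by (auto simp: bounded_clinear_def)
  show ?thesis
  proof
    show "sqrt K * M \<ge> 0" using K M by simp
    fix \<omega> :: complex assume \<omega>: "cmod \<omega> < 1"
    define r where "r = (cmod \<omega>)\<^sup>2"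
    have r: "0 \<le> r" "r < 1" using \<omega> by (auto simp: r_def power_less_one_iff abs_square_less_1)
    \<comment> \<open>\<open>Q\<close> is the square root of the product of the two Cauchy-Schwarz
      bounds; its power of 1 - r is inverse to the weight in the claim, which leaves
      \<open>sqrt K * M\<close>.\<close>
    define Q where "Q = sqrt K * (1 - r) powr - ((1 + \<beta>) / 2) * M"
    have Q: "Q \<ge> 0" using K M by (simp add: Q_def)
    have Q2: "(Q * z)\<^sup>2 = K * (1 - r) powr - (1 + \<beta>) * (M\<^sup>2 * z\<^sup>2)" for z
    proof -
      have "((1 - r) powr - ((1 + \<beta>) / 2))\<^sup>2 = (1 - r) powr - (1 + \<beta>)"
        unfolding power2_eq_square powr_add[symmetric] by (simp only: minus_add_distrib[symmetric] field_sum_of_halves)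
      then show ?thesis using K by (simp add: Q_def power_mult_distrib)
    qed
    have bound: "norm ((C \<circ> (resolvent_op T \<omega> ^^ (m + 1))) x) \<le> Q * norm x" for x
    proof -
      define f where "f k = (of_nat ((k + m) choose m) * \<omega> ^ k) *\<^sub>C C ((T ^^ k) x)" for k
      have sums: "f sums ((C \<circ> (resolvent_op T \<omega> ^^ (m + 1))) x)"
        using bounded_linear.sums[OF C_lin resolvent_op_funpow_sums[OF T \<omega>, of m x]]
        by (simp add: f_def[abs_def] C_sc)
      \<comment> \<open>Since m = \<alpha>/2 + \<beta>/2, the binomial weight (k+1)^m splits into a
        factor for the scalar series and a factor for the admissibility series.\<close>
      define u where "u k = real (Suc k) powr (\<beta> / 2) * cmod \<omega> ^ k" for k
      define v where "v k = real (Suc k) powr (\<alpha> / 2) * norm (C ((T ^^ k) x))" for k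
      have powr2: "(real (Suc k) powr (y / 2))\<^sup>2 = real (Suc k) powr y" for k y
        by (simp add: power2_eq_square flip: powr_add)
      have u2: "(u k)\<^sup>2 = real (Suc k) powr \<beta> * r ^ k" for k
        by (simp only: u_def r_def power_mult_distrib powr2) (simp add: power_mult[symmetric] mult.commute)
      have v2: "(v k)\<^sup>2 = (real k + 1) powr \<alpha> * (norm (C ((T ^^ k) x)))\<^sup>2" for k
        by (simp only: v_def power_mult_distrib powr2) (simp add: add.commute)
      have f_le: "norm (f k) \<le> u k * v k" for k
      proof -
        have "real ((k + m) choose m) \<le> real (Suc k) powr real m"
          using binomial_add_le_power[of k m] by (simp add: powr_realpow del: of_nat_Suc flip: of_nat_power)
        also have "\<dots> = real (Suc k) powr (\<beta> / 2) * real (Suc k) powr (\<alpha> / 2)"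
          unfolding powr_add[symmetric] m by (simp add: field_simps)
        finally have "norm (f k) \<le> (real (Suc k) powr (\<beta> / 2) * real (Suc k) powr (\<alpha> / 2)) * cmod \<omega> ^ k * norm (C ((T ^^ k) x))"
          unfolding f_def norm_scaleC norm_mult norm_power norm_of_nat
          by (intro mult_right_mono) auto
        then show ?thesis by (simp add: u_def v_def mult_ac)
      qed
      have "norm (\<Sum>k<n. f k) \<le> Q * norm x" for n
      proof (rule power2_le_imp_le)
        have "norm (\<Sum>k<n. f k) \<le> (\<Sum>k<n. u k * v k)"
          by (rule sum_norm_le) (rule f_le)
        then have "(norm (\<Sum>k<n. f k))\<^sup>2 \<le> (\<Sum>k<n. u k * v k)\<^sup>2"
          by (intro power_mono) auto
        also have "\<dots> \<le> (\<Sum>k<n. (u k)\<^sup>2) * (\<Sum>k<n. (v k)\<^sup>2)"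
          by (rule Cauchy_Schwarz_ineq_sum)
        also have "\<dots> \<le> (K * (1 - r) powr - (1 + \<beta>)) * (M\<^sup>2 * (norm x)\<^sup>2)"
        proof (rule mult_mono)
          show "(\<Sum>k<n. (u k)\<^sup>2) \<le> K * (1 - r) powr - (1 + \<beta>)"
            unfolding u2 using r by (intro order_trans[OF sum_le_suminf K(3)] K(2)) auto
          show "(\<Sum>k<n. (v k)\<^sup>2) \<le> M\<^sup>2 * (norm x)\<^sup>2"
            unfolding v2 by (intro order_trans[OF sum_le_suminf M(3)] M(2)) auto
        qed (use K in \<open>auto intro: sum_nonneg\<close>)
        finally show "(norm (\<Sum>k<n. f k))\<^sup>2 \<le> (Q * norm x)\<^sup>2"
          by (simp only: Q2)
      qed (use Q in auto)
      then show ?thesis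
        using sums unfolding sums_def by (intro LIMSEQ_le_const2[OF tendsto_norm]) auto
    qed
    have "(1 - r) powr ((1 + \<beta>) / 2) * onorm (C \<circ> (resolvent_op T \<omega> ^^ (m + 1)))
        \<le> (1 - r) powr ((1 + \<beta>) / 2) * Q"
      by (intro mult_left_mono onorm_bound[OF Q bound]) auto
    also have "\<dots> = ((1 - r) powr ((1 + \<beta>) / 2) * (1 - r) powr - ((1 + \<beta>) / 2)) * (sqrt K * M)"
      by (simp only: Q_def mult_ac)
    also have "\<dots> = sqrt K * M"
      using r unfolding powr_add[symmetric] by simp
    finally show "(1 - (cmod \<omega>)\<^sup>2) powr ((1 + \<beta>) / 2) * onorm (C \<circ> (resolvent_op T \<omega> ^^ (m + 1))) \<le> sqrt K * M"
      by (simp add: r_def)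
  qed
qed

section \<open>From the resolvent bound to decay of \<open>C T^n\<close>\<close>

text \<open>With s = (1+\<beta>)/2, the resolvent power costs (k+1)^s and each of the m+1 cancelling
  factors gains 1/(k+1). As m+1 = s + e, the net rate is (k+1)^(-e) along the multiples of m+1;
  division with remainder reaches all n.\<close>

lemma resolvent_bound_imp_decay:
  fixes T :: "'a::complex_banach \<Rightarrow> 'a" and C :: "'a \<Rightarrow> 'b::complex_banach"
  assumes T: "ritt_operator T" and C: "bounded_clinear C" and "- 1 < \<alpha>" "- 1 < \<beta>"
    and m: "real m = (\<alpha> + \<beta>) / 2" and "K \<ge> 0"
    and K: "\<And>\<omega>. cmod \<omega> < 1 \<Longrightarrow>
      (1 - (cmod \<omega>)\<^sup>2) powr ((1 + \<beta>) / 2) * onorm (C \<circ> (resolvent_op T \<omega> ^^ (m + 1))) \<le> K"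
  obtains c where "c \<ge> 0"
    "\<And>n x. norm (C ((T ^^ n) x)) \<le> c * real (Suc n) powr - ((1 + \<alpha>) / 2) * norm x"
proof -
  have pb: "power_bounded T" using T by (simp add: ritt_operator_def)
  then have T_cl: "bounded_clinear T" by (simp add: power_bounded_def)
  have C_lin: "bounded_linear C" using C by (simp add: bounded_clinear_def)
  obtain B where B: "B \<ge> 0" "\<And>k x. norm ((T ^^ k) x) \<le> B * norm x"
    using power_boundedE[OF pb] by blast
  obtain d where d: "d \<ge> 0"
    "\<And>k x. norm ((T ^^ Suc k) x - (T ^^ k) x) \<le> d / real (Suc k) * norm x"
    using ritt_operatorE[OF T] by blast
  define e where "e = (1 + \<alpha>) / 2"
  define s where "s = (1 + \<beta>) / 2"
  define b where "b = d + B"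
  have e: "e > 0" and s: "s > 0" "s - real (Suc m) = - e" and b: "b \<ge> 0"
    using assms B d m by (auto simp: e_def s_def b_def field_simps)
  have block: "norm (C ((T ^^ (k * Suc m)) x)) \<le> K * b ^ Suc m * real (Suc k) powr - e * norm x" for k x
  proof -
    \<comment> \<open>This r gives 1 - r = 1/(k+1), so both summands of \<open>G\<close> below have
      order 1/(k+1), with constants \<open>d\<close> (Ritt) and \<open>B\<close> (power
      bound).\<close>
    define r where "r = real k / real (Suc k)"
    define R where "R = resolvent_op T (complex_of_real r)"
    define G where "G y = (T ^^ k) y - complex_of_real r *\<^sub>C T ((T ^^ k) y)" for y
    have r: "0 \<le> r" "r < 1" "1 - r = 1 / real (Suc k)" by (auto simp: r_def field_simps)
    then have cr: "cmod (complex_of_real r) < 1" by simp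
    have Tk: "bounded_linear (T ^^ k)" "\<And>c y. (T ^^ k) (c *\<^sub>C y) = c *\<^sub>C (T ^^ k) y"
      using bounded_clinear_funpow[OF T_cl, of k] by (auto simp: bounded_clinear_def)
    have "G ((T ^^ k) y) = (T ^^ k) (G y)" for y
      using Tk(2) by (simp add: G_def linear_diff[OF bounded_linear.linear[OF Tk(1)]] funpow_swap1)
    \<comment> \<open>Moving \<open>T^k\<close> past the powers of \<open>G\<close> lets each
      \<open>R\<close> meet a \<open>G\<close> directly, so commutation of \<open>R\<close> with
      \<open>T\<close> is never invoked.\<close>
    then have Gcomm: "(G ^^ p) ((T ^^ k) y) = (T ^^ k) ((G ^^ p) y)" for p y
      by (induction p) auto
    have "norm (G y) \<le> b / real (Suc k) * norm y" for y
    proof -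
      have "G y = ((T ^^ k) y - (T ^^ Suc k) y) + (1 - r) *\<^sub>R (T ^^ Suc k) y"
        by (simp add: G_def scaleC_of_real scaleR_left_diff_distrib)
      also have "norm \<dots> \<le> d / real (Suc k) * norm y + (1 - r) * (B * norm y)"
      proof (intro norm_triangle_le add_mono)
        show "norm ((T ^^ k) y - (T ^^ Suc k) y) \<le> d / real (Suc k) * norm y"
          using d(2)[of k y] by (simp only: norm_minus_commute)
        show "norm ((1 - r) *\<^sub>R (T ^^ Suc k) y) \<le> (1 - r) * (B * norm y)"
          using r(2) mult_left_mono[OF B(2)[of "Suc k" y], of "1 - r"] by simp
      qed
      also have "\<dots> = b / real (Suc k) * norm y"
        unfolding r(3) b_def by (simp add: add_divide_distrib distrib_right)
      finally show ?thesis .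
    qed
    then have Gp: "norm ((G ^^ p) y) \<le> (b / real (Suc k)) ^ p * norm y" for p y
    proof (induction p)
      case (Suc p)
      have "norm ((G ^^ Suc p) y) \<le> b / real (Suc k) * norm ((G ^^ p) y)"
        using Suc.prems by simp
      also have "\<dots> \<le> b / real (Suc k) * ((b / real (Suc k)) ^ p * norm y)"
        using Suc b by (intro mult_left_mono) auto
      finally show ?case by (simp add: mult_ac)
    qed simp
    have RG: "R (G y) = (T ^^ k) y" for y
      unfolding R_def G_def by (rule resolvent_op_cancel[OF pb cr])
    have "(R ^^ p) ((G ^^ p) y) = (T ^^ (k * p)) y" for p y
    proof (induction p arbitrary: y)
      case (Suc p)
      have "(R ^^ Suc p) ((G ^^ Suc p) y) = (R ^^ p) (R (G ((G ^^ p) y)))"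
        by (simp add: funpow_swap1)
      also have "\<dots> = (T ^^ (k * p)) ((T ^^ k) y)" by (simp add: RG Suc flip: Gcomm)
      also have "\<dots> = (T ^^ (k * Suc p)) y" by (simp only: mult_Suc_right add.commute[of k] funpow_add comp_apply)
      finally show ?case .
    qed simp
    then have eq: "C ((T ^^ (k * Suc m)) x) = (C \<circ> (R ^^ Suc m)) ((G ^^ Suc m) x)"
      by (metis comp_apply)
    have "bounded_linear (R ^^ Suc m)"
      using bounded_clinear_funpow[OF power_bounded_invertible(2)[OF pb cr], of "Suc m"]
      unfolding R_def bounded_clinear_def by blast
    then have lin: "bounded_linear (C \<circ> (R ^^ Suc m))"
      using bounded_linear_compose[OF C_lin] by (simp add: comp_def)
    \<comment> \<open>Here r^2 \<le> r, hence 1 - r^2 \<ge> 1 - r = 1/(k+1).\<close>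
    have "(1 / real (Suc k)) powr s * onorm (C \<circ> (R ^^ Suc m)) \<le> (1 - r\<^sup>2) powr s * onorm (C \<circ> (R ^^ Suc m))"
      using r s mult_left_le[of r r] onorm_pos_le[OF lin] unfolding r(3)[symmetric]
      by (intro mult_right_mono powr_mono2) (auto simp: power2_eq_square)
    also have "\<dots> \<le> K"
      using K[OF cr] by (simp add: R_def s_def)
    finally have on: "onorm (C \<circ> (R ^^ Suc m)) \<le> K * real (Suc k) powr s"
      by (simp add: powr_divide field_simps)
    have "norm (C ((T ^^ (k * Suc m)) x)) \<le> onorm (C \<circ> (R ^^ Suc m)) * norm ((G ^^ Suc m) x)"
      unfolding eq by (rule onorm[OF lin])
    also have "\<dots> \<le> (K * real (Suc k) powr s) * ((b / real (Suc k)) ^ Suc m * norm x)"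
      using \<open>K \<ge> 0\<close> by (intro mult_mono on Gp) auto
    also have "\<dots> = K * b ^ Suc m * (real (Suc k) powr s / real (Suc k) ^ Suc m) * norm x"
      by (simp only: power_divide) (simp del: of_nat_Suc power_Suc)
    also have "real (Suc k) powr s / real (Suc k) ^ Suc m = real (Suc k) powr - e"
      using powr_diff[of "real (Suc k)" s "real (Suc m)"] powr_realpow[of "real (Suc k)" "Suc m"]
      unfolding s(2) by simp
    finally show ?thesis .
  qed
  \<comment> \<open>The factor (m+1)^e accounts for n+1 \<le> (m+1)(k+1), and \<open>B\<close> for
    the remaining power \<open>T^(n mod (m+1))\<close>.\<close>
  define c where "c = K * b ^ Suc m * real (Suc m) powr e * B"
  show ?thesis
  proof
    show "c \<ge> 0" using \<open>K \<ge> 0\<close> b B by (simp add: c_def)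
    fix n x
    define k where "k = n div Suc m"
    have n: "n = k * Suc m + n mod Suc m" by (simp only: k_def div_mult_mod_eq)
    have "n mod Suc m < Suc m" by simp
    with n have "Suc n \<le> k * Suc m + Suc m" by linarith
    also have "\<dots> = Suc m * Suc k" by simp
    finally have "Suc n \<le> Suc m * Suc k" .
    then have "real (Suc n) \<le> real (Suc m) * real (Suc k)"
      by (metis of_nat_le_iff of_nat_mult)
    then have "(real (Suc m) * real (Suc k)) powr - e \<le> real (Suc n) powr - e"
      using e by (intro powr_mono2') auto
    then have k_le: "real (Suc k) powr - e \<le> real (Suc m) powr e * real (Suc n) powr - e"
      by (simp add: powr_mult powr_minus field_simps del: of_nat_Suc)
    have "(T ^^ n) x = (T ^^ (k * Suc m)) ((T ^^ (n mod Suc m)) x)"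
      by (subst n) (simp only: funpow_add comp_apply)
    then have "norm (C ((T ^^ n) x)) \<le> K * b ^ Suc m * real (Suc k) powr - e * norm ((T ^^ (n mod Suc m)) x)"
      using block by simp
    also have "\<dots> \<le> K * b ^ Suc m * (real (Suc m) powr e * real (Suc n) powr - e) * (B * norm x)"
      using \<open>K \<ge> 0\<close> b by (intro mult_mono k_le B) auto
    finally show "norm (C ((T ^^ n) x)) \<le> c * real (Suc n) powr - ((1 + \<alpha>) / 2) * norm x"
      by (simp only: c_def e_def mult_ac)
  qed
qed

section \<open>From decay and the square function estimate to admissibility\<close>

lemma admissible_if_decay:
  fixes T :: "'a::complex_banach \<Rightarrow> 'a" and C :: "'a \<Rightarrow> 'b::complex_banach"
  assumes T: "power_bounded T" and sq: "square_function_estimate T" and C: "bounded_clinear C"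
    and "- 1 < \<alpha>" and "c \<ge> 0"
    and decay: "\<And>n x. norm (C ((T ^^ n) x)) \<le> c * real (Suc n) powr - ((1 + \<alpha>) / 2) * norm x"
  shows "admissible \<alpha> T C"
proof -
  define e where "e = (1 + \<alpha>) / 2"
  have e: "e > 0" "\<alpha> = 2 * e - 1" using \<open>- 1 < \<alpha>\<close> by (auto simp: e_def field_simps)
  have T_lin: "bounded_linear T" using T by (simp add: power_bounded_def bounded_clinear_def)
  have Tn_lin: "linear (T ^^ n)" for n
    using bounded_clinear_funpow[of T n] T
    by (auto simp: power_bounded_def bounded_clinear_def intro: bounded_linear.linear)
  have C_lin: "linear C" using C by (auto simp: bounded_clinear_def intro: bounded_linear.linear)
  obtain B where B: "B \<ge> 0" "\<And>k x. norm ((T ^^ k) x) \<le> B * norm x"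
    using power_boundedE[OF T] by blast
  obtain H where H: "H \<ge> 0"
    "\<And>g n. (\<Sum>k<n. real (Suc k) powr (2 * e - 1) * (\<Sum>j=k..<n. real (Suc j) powr (- e) * g j)\<^sup>2)
            \<le> H * (\<Sum>j<n. real (Suc j) * (g j)\<^sup>2)"
    using discrete_hardy[OF e(1)] by blast
  obtain \<kappa> where \<kappa>:
    "\<And>x. summable (\<lambda>k. real (Suc k) * (norm ((T ^^ Suc k) x - (T ^^ k) x))\<^sup>2)"
    "\<And>x. (\<Sum>k. real (Suc k) * (norm ((T ^^ Suc k) x - (T ^^ k) x))\<^sup>2) \<le> \<kappa>\<^sup>2 * (norm x)\<^sup>2"
    using sq unfolding square_function_estimate_def by blast
  \<comment> \<open>\<open>c\<close> comes from the decay of \<open>C T^j\<close>, and 1 + B bounds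
    I + T.\<close>
  define d where "d = c * (1 + B)"
  define Q where "Q = H * (d\<^sup>2 * \<kappa>\<^sup>2)"
  have Q: "Q \<ge> 0" using H by (simp add: Q_def)
  have even_bound: "(\<Sum>k<n. real (Suc k) powr \<alpha> * (norm (C ((T ^^ (2 * k)) x)))\<^sup>2) \<le> Q * (norm x)\<^sup>2"
    for n x
  proof -
    define D where "D j = C ((T ^^ (2 * j)) x)" for j
    define g where "g j = d * norm ((T ^^ Suc j) x - (T ^^ j) x)" for j
    \<comment> \<open>Half of the power 2j feeds the decay of \<open>C T^j\<close>; the other half
      stays in the difference measured by the square function.\<close>
    have D_step: "norm (D j - D (Suc j)) \<le> real (Suc j) powr - e * g j" for j
    proof -
      define w where "w = (T ^^ j) x - (T ^^ Suc j) x"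
      have "(T ^^ j) (w + T w) = (T ^^ (j + j)) x - (T ^^ (j + Suc (Suc j))) x"
        unfolding funpow_add
        by (simp add: w_def linear_add[OF Tn_lin] linear_diff[OF Tn_lin]
            linear_diff[OF bounded_linear.linear[OF T_lin]])
      then have "D j - D (Suc j) = C ((T ^^ j) (w + T w))"
        by (simp add: D_def linear_diff[OF C_lin] mult_2)
      also have "norm \<dots> \<le> c * real (Suc j) powr - e * norm (w + T w)"
        using decay by (simp add: e_def)
      also have "\<dots> \<le> c * real (Suc j) powr - e * ((1 + B) * norm w)"
        using \<open>c \<ge> 0\<close> B(2)[of 1 w]
        by (intro mult_left_mono norm_triangle_le) (auto simp: distrib_right)
      finally show ?thesis by (simp add: g_def d_def w_def norm_minus_commute mult_ac)
    qed
    have D_diff: "norm (D k - D N) \<le> (\<Sum>j=k..<N. real (Suc j) powr - e * g j)" if "k \<le> N" for k N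
    proof -
      have "D k - D N = (\<Sum>j=k..<N. D j - D (Suc j))"
        using sum_Suc_diff'[OF that, of "\<lambda>j. - D j"] by simp
      also have "norm \<dots> \<le> (\<Sum>j=k..<N. real (Suc j) powr - e * g j)"
        by (rule sum_norm_le) (rule D_step)
      finally show ?thesis .
    qed
    \<comment> \<open>Subtracting \<open>D N\<close> turns the infinite tail into a finite sum, to
      which the Hardy inequality applies with a bound uniform in N; afterwards N tends to infinity
      with n fixed.\<close>
    have D_sum: "(\<Sum>k<n. real (Suc k) powr \<alpha> * (norm (D k - D N))\<^sup>2) \<le> Q * (norm x)\<^sup>2"
      if "n \<le> N" for N
    proof -
      have "(\<Sum>k<n. real (Suc k) powr \<alpha> * (norm (D k - D N))\<^sup>2)
          \<le> (\<Sum>k<N. real (Suc k) powr \<alpha> * (norm (D k - D N))\<^sup>2)"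
        using that by (intro sum_mono2) auto
      also have "\<dots> \<le> (\<Sum>k<N. real (Suc k) powr (2 * e - 1) * (\<Sum>j=k..<N. real (Suc j) powr (- e) * g j)\<^sup>2)"
        unfolding e(2) by (intro sum_mono mult_left_mono power_mono D_diff) auto
      also have "\<dots> \<le> H * (\<Sum>j<N. real (Suc j) * (g j)\<^sup>2)" by (rule H)
      also have "(\<Sum>j<N. real (Suc j) * (g j)\<^sup>2)
          = d\<^sup>2 * (\<Sum>j<N. real (Suc j) * (norm ((T ^^ Suc j) x - (T ^^ j) x))\<^sup>2)"
        by (simp add: g_def power_mult_distrib sum_distrib_left mult_ac del: of_nat_Suc)
      also have "H * \<dots> \<le> H * (d\<^sup>2 * (\<kappa>\<^sup>2 * (norm x)\<^sup>2))"
        using H by (intro mult_left_mono order_trans[OF sum_le_suminf \<kappa>(2)] \<kappa>(1)) auto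
      finally show ?thesis by (simp add: Q_def mult_ac)
    qed
    \<comment> \<open>This rests on e > 0, that is, on \<alpha> > -1.\<close>
    have "D \<longlonglongrightarrow> 0"
    proof (rule Lim_null_comparison)
      have "filterlim (\<lambda>n. real (Suc (2 * n))) at_top sequentially"
        by (rule filterlim_compose[OF filterlim_real_sequentially])
          (rule filterlim_subseq, simp add: strict_mono_def)
      from tendsto_neg_powr[OF _ this, of "- e"] e
      have "(\<lambda>n. real (Suc (2 * n)) powr - e) \<longlonglongrightarrow> 0" by simp
      then show "(\<lambda>n. c * real (Suc (2 * n)) powr - e * norm x) \<longlonglongrightarrow> 0"
        by (intro tendsto_mult_left_zero tendsto_mult_right_zero)
      show "\<forall>\<^sub>F n in sequentially. norm (D n) \<le> c * real (Suc (2 * n)) powr - e * norm x"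
        unfolding D_def e_def using decay by (intro always_eventually allI)
    qed
    then have "(\<lambda>N. \<Sum>k<n. real (Suc k) powr \<alpha> * (norm (D k - D N))\<^sup>2)
        \<longlonglongrightarrow> (\<Sum>k<n. real (Suc k) powr \<alpha> * (norm (D k - 0))\<^sup>2)"
      by (intro tendsto_intros)
    from LIMSEQ_le_const2[OF this] D_sum show ?thesis by (auto simp: D_def)
  qed
  \<comment> \<open>The first summand serves the even indices, where 1 + 2^\<alpha> covers both
    signs of \<alpha>. The second serves the odd ones, treated as even indices for
    \<open>T x\<close>, whence the B^2.\<close>
  define L where "L = (1 + 2 powr \<alpha>) * Q + 2 powr \<alpha> * (Q * B\<^sup>2)"
  have L: "L \<ge> 0" using Q by (simp add: L_def)
  show ?thesis unfolding admissible_def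
  proof (intro exI[of _ "sqrt L"] conjI allI)
    show "sqrt L \<ge> 0" using L by simp
    fix x
    define a where "a k = (real k + 1) powr \<alpha> * (norm (C ((T ^^ k) x)))\<^sup>2" for k
    have a_nonneg: "a k \<ge> 0" for k by (simp add: a_def)
    have weight: "(real (2 * k) + 1) powr \<alpha> \<le> (1 + 2 powr \<alpha>) * real (Suc k) powr \<alpha>" for k
    proof (cases "\<alpha> \<ge> 0")
      case True
      then have "(real (2 * k) + 1) powr \<alpha> \<le> (2 * real (Suc k)) powr \<alpha>"
        by (intro powr_mono2) auto
      then show ?thesis by (simp only: powr_mult distrib_right) (simp add: add_increasing)
    next
      case False
      then have "(real (2 * k) + 1) powr \<alpha> \<le> real (Suc k) powr \<alpha>"
        by (intro powr_mono2') auto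
      then show ?thesis by (simp add: distrib_right add_increasing2)
    qed
    have a_even: "a (2 * k) \<le> (1 + 2 powr \<alpha>) * (real (Suc k) powr \<alpha> * (norm (C ((T ^^ (2 * k)) x)))\<^sup>2)" for k
      using mult_right_mono[OF weight, of "(norm (C ((T ^^ (2 * k)) x)))\<^sup>2" k]
      by (simp only: a_def mult.assoc zero_le_power2 simp_thms)
    have a_odd: "a (Suc (2 * k)) = 2 powr \<alpha> * (real (Suc k) powr \<alpha> * (norm (C ((T ^^ (2 * k)) (T x))))\<^sup>2)" for k
    proof -
      have "real (Suc (2 * k)) + 1 = 2 * real (Suc k)" by simp
      then have "(real (Suc (2 * k)) + 1) powr \<alpha> = 2 powr \<alpha> * real (Suc k) powr \<alpha>"
        by (simp only: powr_mult)
      then show ?thesis by (simp add: a_def funpow_swap1)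
    qed
    have partial: "sum a {..<n} \<le> L * (norm x)\<^sup>2" for n
    proof -
      have "sum a {..<n} \<le> sum a {..<2 * n}"
        by (intro sum_mono2 a_nonneg) auto
      also have "\<dots> = (\<Sum>k<n. a (2 * k)) + (\<Sum>k<n. a (Suc (2 * k)))"
        by (induction n) auto
      also have "\<dots> \<le> (1 + 2 powr \<alpha>) * (\<Sum>k<n. real (Suc k) powr \<alpha> * (norm (C ((T ^^ (2 * k)) x)))\<^sup>2)
          + 2 powr \<alpha> * (\<Sum>k<n. real (Suc k) powr \<alpha> * (norm (C ((T ^^ (2 * k)) (T x))))\<^sup>2)"
        unfolding sum_distrib_left a_odd by (intro add_mono sum_mono a_even) auto
      also have "\<dots> \<le> (1 + 2 powr \<alpha>) * (Q * (norm x)\<^sup>2) + 2 powr \<alpha> * (Q * (norm (T x))\<^sup>2)"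
        by (intro add_mono mult_left_mono even_bound) auto
      also have "\<dots> \<le> (1 + 2 powr \<alpha>) * (Q * (norm x)\<^sup>2) + 2 powr \<alpha> * (Q * (B * norm x)\<^sup>2)"
        using Q B(2)[of 1 x] by (intro add_left_mono mult_left_mono power_mono) auto
      also have "\<dots> = L * (norm x)\<^sup>2"
        by (simp add: L_def power_mult_distrib algebra_simps)
      finally show ?thesis .
    qed
    have sm: "summable a" by (rule summableI_nonneg_bounded[OF a_nonneg partial])
    then show "summable (\<lambda>k. (real k + 1) powr \<alpha> * (norm (C ((T ^^ k) x)))\<^sup>2)"
      by (simp only: a_def[abs_def])
    show "(\<Sum>k. (real k + 1) powr \<alpha> * (norm (C ((T ^^ k) x)))\<^sup>2) \<le> (sqrt L)\<^sup>2 * (norm x)\<^sup>2"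
      using suminf_le_const[OF sm partial] L by (simp add: a_def[abs_def])
  qed
qed

theorem theorem3p1:
  fixes T :: "'a::complex_banach \<Rightarrow> 'a"
    and C :: "'a \<Rightarrow> 'b::complex_banach"
    and \<alpha> \<beta> :: real and m :: nat
  assumes "reflexive_space TYPE('a)"
    and "ritt_operator T"
    and "square_function_estimate T"
    and "\<alpha> > -1" and "-1 < \<beta>" and "\<beta> < 3"
    and "real m = (\<alpha> + \<beta>) / 2"
    and "bounded_clinear C"
  shows "admissible \<alpha> T C \<longleftrightarrow>
    (\<exists>K\<ge>0. \<forall>\<omega>::complex. cmod \<omega> < 1 \<longrightarrow>
       (1 - (cmod \<omega>)\<^sup>2) powr ((1 + \<beta>) / 2) * onorm (C \<circ> (resolvent_op T \<omega> ^^ (m + 1))) \<le> K)"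
    (is "_ \<longleftrightarrow> ?bound")
proof
  have T: "power_bounded T" using assms(2) by (simp add: ritt_operator_def)
  show ?bound if "admissible \<alpha> T C"
    using admissible_imp_resolvent_bound[OF T assms(8) that assms(5,7)] by metis
  assume ?bound
  then obtain K where "K \<ge> 0" "\<And>\<omega>. cmod \<omega> < 1 \<Longrightarrow>
      (1 - (cmod \<omega>)\<^sup>2) powr ((1 + \<beta>) / 2) * onorm (C \<circ> (resolvent_op T \<omega> ^^ (m + 1))) \<le> K"
    by blast
  from resolvent_bound_imp_decay[OF assms(2,8,4,5,7) this]
  obtain c where "c \<ge> 0"
    "\<And>n x. norm (C ((T ^^ n) x)) \<le> c * real (Suc n) powr - ((1 + \<alpha>) / 2) * norm x"
    by blast
  then show "admissible \<alpha> T C"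
    by (rule admissible_if_decay[OF T assms(3,8,4)])
qed

end
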